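(* Let $F$ be a field with $|F|>2$. The maximal $\mathrm{GL}_2(F)$-independent subsets of $\mathrm{Sub}(F^2)$ are exactly the subsets consisting of three (distinct) $1$-dimensional subspaces of $F^2$. Hence $$\mathrm{indep}_{\mathrm{GL}_2(F)}\mathrm{Sub}(F^2)=\mathrm{indep}_{\mathrm{GL}_2(F)}\mathbb{P}^1=3,$$ where $\mathbb{P}^1=\mathrm{Sub}(F^2)-\{0,F^2\}$ is the set of $1$-dimensional subspaces of $F^2$.
   Context: $\mathrm{Sub}(F^n)$ denotes the set of all $F$-subspaces of $F^n$, on which $\mathrm{GL}_n(F)$ acts by $g\cdot V=g(V)$. For a group $G$ acting on a set $X$, a subset $Y\subseteq X$ is called $G$-independent if for every $y\in Y$ there is $g\in G$ that fixes every element of $Y-\{y\}$ and does not fix $y$. The $G$-independence number $\mathrm{indep}_G X$ is the largest possible size of a $G$-independent subset of $X$. *)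

theory Defs
  imports "HOL-Analysis.Cartesian_Space" "HOL-Algebra.Group_Action" "HOL-Library.Extended_Nat"
begin

text \<open>
  Independence for a group \<open>G\<close> acting on a set \<open>X\<close>. As in \<^locale>\<open>group_action\<close>, the action is
  a homomorphism \<open>\<phi>\<close> from \<open>G\<close> to the permutations of \<open>X\<close>; ``\<open>g\<close> fixes \<open>y\<close>'' means
  \<open>\<phi> g y = y\<close>, so a subspace is fixed as a set, not pointwise.
\<close>

definition G_independent :: "('g, 'm) monoid_scheme \<Rightarrow> ('g \<Rightarrow> 'x \<Rightarrow> 'x) \<Rightarrow> 'x set \<Rightarrow> bool" where
  "G_independent G \<phi> Y \<longleftrightarrow>
     (\<forall>y\<in>Y. \<exists>g\<in>carrier G. (\<forall>z\<in>Y - {y}. \<phi> g z = z) \<and> \<phi> g y \<noteq> y)"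

text \<open>Maximality is with respect to inclusion.\<close>

definition maximal_G_independent ::
    "('g, 'm) monoid_scheme \<Rightarrow> 'x set \<Rightarrow> ('g \<Rightarrow> 'x \<Rightarrow> 'x) \<Rightarrow> 'x set \<Rightarrow> bool" where
  "maximal_G_independent G X \<phi> Y \<longleftrightarrow>
     Y \<subseteq> X \<and> G_independent G \<phi> Y \<and>
     (\<forall>Z. Z \<subseteq> X \<and> G_independent G \<phi> Z \<and> Y \<subseteq> Z \<longrightarrow> Z = Y)"

text \<open>
  Sizes are taken in \<^typ>\<open>enat\<close>, since \<^const>\<open>card\<close> is \<open>0\<close> on infinite sets. A finite nonzero
  supremum in \<^typ>\<open>enat\<close> is attained, so a finite value of \<open>indep\<close> is a largest size.
\<close>

definition esize :: "'x set \<Rightarrow> enat" where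
  "esize Y = (if finite Y then enat (card Y) else \<infinity>)"

definition indep :: "('g, 'm) monoid_scheme \<Rightarrow> 'x set \<Rightarrow> ('g \<Rightarrow> 'x \<Rightarrow> 'x) \<Rightarrow> enat" where
  "indep G X \<phi> = (SUP Y\<in>{Y. Y \<subseteq> X \<and> G_independent G \<phi> Y}. esize Y)"

definition GL :: "('a::field ^'n^'n) monoid" where
  "GL = \<lparr>carrier = {A. invertible A}, mult = (**), one = mat 1\<rparr>"

definition Sub :: "('a::field ^'n) set set" where
  "Sub = {V. vec.subspace V}"

definition P1 :: "('a::field ^2) set set" where
  "P1 = Sub - {{0}, UNIV}"

text \<open>
  The action \<open>A \<cdot> V = A(V)\<close> on a \<open>GL\<close>-stable set \<open>X\<close> of sets of vectors; the restrictions are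
  needed because \<^const>\<open>BijGroup\<close> consists of extensional functions.
\<close>

definition GL_act :: "('a::field ^'n) set set \<Rightarrow> 'a^'n^'n \<Rightarrow> ('a^'n) set \<Rightarrow> ('a^'n) set" where
  "GL_act X A = (\<lambda>V\<in>X. (*v) A ` V)"

lemma group_GL: "group (GL :: ('a::field ^'n^'n) monoid)"
proof (rule groupI)
  fix A :: "'a^'n^'n" assume "A \<in> carrier GL"
  then obtain B where "A ** B = mat 1" "B ** A = mat 1"
    by (auto simp: GL_def invertible_def)
  then show "\<exists>B\<in>carrier GL. B \<otimes>\<^bsub>GL\<^esub> A = \<one>\<^bsub>GL\<^esub>"
    by (auto simp: GL_def invertible_def)
qed (auto simp: GL_def invertible_mult matrix_mul_assoc invertible_def[of "mat 1"])

lemma group_action_GL_act: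
  fixes X :: "('a::field ^'n) set set"
  assumes stable: "\<And>A V. invertible A \<Longrightarrow> V \<in> X \<Longrightarrow> (*v) A ` V \<in> X"
  shows "group_action GL X (GL_act X)"
proof -
  have Bij: "GL_act X A \<in> Bij X" if A: "invertible A" for A :: "'a^'n^'n"
  proof -
    obtain B where B: "A ** B = mat 1" "B ** A = mat 1"
      using A by (auto simp: invertible_def)
    then have "invertible B" by (auto simp: invertible_def)
    then have "bij_betw (GL_act X A) X X"
      using A B stable
      by (intro bij_betw_byWitness[where f' = "GL_act X B"])
         (auto simp: GL_act_def image_image matrix_vector_mul_assoc)
    then show ?thesis by (simp add: Bij_def GL_act_def)
  qed
  have "GL_act X (A ** B) = compose X (GL_act X A) (GL_act X B)"
    if "invertible B" for A B :: "'a^'n^'n"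
    using that stable
    by (auto simp: fun_eq_iff GL_act_def compose_def image_image matrix_vector_mul_assoc)
  then show ?thesis
    using Bij group_GL group_BijGroup[of X]
    unfolding group_action_def group_hom_def group_hom_axioms_def hom_def
    by (auto simp: BijGroup_def GL_def)
qed

lemma Sub_stable:
  fixes A :: "'a::field ^'n^'n"
  assumes "V \<in> Sub"
  shows "(*v) A ` V \<in> Sub"
  using assms
  by (auto simp: Sub_def intro: vec.linear_subspace_image)

lemma P1_stable:
  fixes A :: "'a::field ^2^2"
  assumes A: "invertible A" and V: "V \<in> P1"
  shows "(*v) A ` V \<in> P1"
proof -
  obtain B where B: "A ** B = mat 1" "B ** A = mat 1"
    using A by (auto simp: invertible_def)
  have BAV: "(*v) B ` (*v) A ` V = V"
    by (simp add: image_image matrix_vector_mul_assoc B)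
  have "surj ((*v) B)"
    using B matrix_right_invertible_surjective by blast
  then have "(*v) A ` V \<noteq> {0}" "(*v) A ` V \<noteq> UNIV"
    using BAV V by (auto simp: P1_def)
  then show ?thesis using V Sub_stable by (auto simp: P1_def)
qed

lemma group_action_Sub: "group_action GL Sub (GL_act (Sub :: ('a::field ^'n) set set))"
  by (rule group_action_GL_act) (rule Sub_stable)

lemma group_action_P1: "group_action GL P1 (GL_act (P1 :: ('a::field ^2) set set))"
  by (rule group_action_GL_act) (rule P1_stable)

end

theory Submission
  imports Defs "HOL-Analysis.Determinants"
begin

text \<open>
  The whole space and the zero space are fixed by every matrix, so independent sets consist of
  lines. A matrix fixing three distinct lines fixes every line, so an
  independent set has at most three elements. Conversely, if \<open>a \<noteq> 0, 1\<close>, the matrix with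
  eigenvalues \<open>1\<close> and \<open>a\<close> (up to a common factor) on two given lines moves every other line, so
  any three lines are independent; and any set of fewer lines extends to a set of three.
\<close>

section \<open>Lines in the plane, described by 2x2 determinants\<close>

definition det2 :: "'a::comm_ring_1 ^2 \<Rightarrow> 'a^2 \<Rightarrow> 'a" where
  "det2 u v = u $ 1 * v $ 2 - u $ 2 * v $ 1"

text \<open>Cramer's rule with denominators cleared: up to the factor \<open>det2 u v\<close>, the
  coordinates of \<open>w\<close> relative to \<open>u\<close>, \<open>v\<close> are
  \<open>det2 w v\<close> and \<open>det2 u w\<close>.\<close>

lemma det2_cramer: "det2 u v *s w = det2 w v *s u + det2 u w *s v"
  by (simp add: vec_eq_iff forall_2 det2_def algebra_simps)

lemma det2_self [simp]: "det2 u u = 0"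
  by (simp add: det2_def)

lemma det2_swap: "det2 v u = - det2 u v"
  by (simp add: det2_def)

lemma in_span_singleton_iff_det2:
  fixes u v :: "'a::field ^2"
  assumes "u \<noteq> 0"
  shows "v \<in> vec.span {u} \<longleftrightarrow> det2 u v = 0"
proof
  assume "v \<in> vec.span {u}"
  then show "det2 u v = 0"
    by (auto simp: vec.span_singleton det2_def)
next
  assume det: "det2 u v = 0"
  from assms consider "u $ 1 \<noteq> 0" | "u $ 2 \<noteq> 0"
    by (auto simp: vec_eq_iff forall_2)
  then show "v \<in> vec.span {u}"
  proof cases
    case 1
    with det have "v = (v $ 1 / u $ 1) *s u"
      by (simp add: vec_eq_iff forall_2 det2_def field_simps)
    then show ?thesis unfolding vec.span_singleton by blast
  next
    case 2
    with det have "v = (v $ 2 / u $ 2) *s u"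
      by (simp add: vec_eq_iff forall_2 det2_def field_simps)
    then show ?thesis unfolding vec.span_singleton by blast
  qed
qed

lemma subspace_eq_UNIV_if_det2:
  fixes u v :: "'a::field ^2"
  assumes V: "vec.subspace V" and uv: "u \<in> V" "v \<in> V" "det2 u v \<noteq> 0"
  shows "V = UNIV"
proof -
  have "x \<in> V" for x
  proof -
    have "x = (det2 x v / det2 u v) *s u + (det2 u x / det2 u v) *s v"
      using arg_cong[OF det2_cramer[of u v x], of "\<lambda>y. (1 / det2 u v) *s y"] uv(3)
      by (simp add: vector_add_ldistrib)
    then show ?thesis
      using V uv by (metis vec.subspace_add vec.subspace_scale)
  qed
  then show ?thesis by auto
qed

text \<open>A member of \<open>P1\<close> contains some nonzero \<open>v\<close>, and a vector of it
  outside the span of \<open>v\<close> would, together with \<open>v\<close>, generate the whole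
  plane.\<close>

lemma P1_iff_span: "V \<in> P1 \<longleftrightarrow> (\<exists>v. v \<noteq> 0 \<and> V = vec.span {v})"
proof
  assume "V \<in> P1"
  then have V: "vec.subspace V" "V \<noteq> {0}" "V \<noteq> UNIV"
    by (auto simp: P1_def Sub_def)
  then obtain v where v: "v \<in> V" "v \<noteq> 0"
    using vec.subspace_0 by blast
  have "V \<subseteq> vec.span {v}"
    using subspace_eq_UNIV_if_det2[OF V(1) v(1)] V(3) in_span_singleton_iff_det2[OF v(2)] by blast
  moreover have "vec.span {v} \<subseteq> V"
    using V v by (simp add: vec.span_minimal)
  ultimately show "\<exists>v. v \<noteq> 0 \<and> V = vec.span {v}"
    using v by blast
next
  assume "\<exists>v. v \<noteq> 0 \<and> V = vec.span {v}"
  then obtain v where v: "v \<noteq> 0" "V = vec.span {v}" by blast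
  \<comment> \<open>Up to sign these are the two coordinates of \<open>v\<close>, so one of the
    standard basis vectors lies outside \<open>V\<close>.\<close>
  have "det2 v (axis 1 1) \<noteq> 0 \<or> det2 v (axis 2 1) \<noteq> 0"
    using v(1) by (auto simp: det2_def axis_def vec_eq_iff forall_2)
  then have "V \<noteq> UNIV"
    using in_span_singleton_iff_det2[OF v(1)] v(2) by auto
  moreover have "V \<noteq> {0}"
    using v vec.span_base[of v "{v}"] by auto
  ultimately show "V \<in> P1"
    using v by (auto simp: P1_def Sub_def)
qed

lemma P1_eq_dim_1: "P1 = {V \<in> Sub. vec.dim V = 1}"
proof (intro equalityI subsetI)
  fix V :: "('a^2) set" assume "V \<in> P1"
  then show "V \<in> {V \<in> Sub. vec.dim V = 1}"
    using P1_iff_span[of V] vec.dim_eq_card_independent[of "{_}"]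
    by (auto simp: P1_def)
next
  fix V :: "('a^2) set" assume "V \<in> {V \<in> Sub. vec.dim V = 1}"
  moreover have "vec.dim ({0} :: ('a^2) set) = 0"
    by (simp add: vec.dim_eq_0)
  moreover have "vec.dim (UNIV :: ('a^2) set) = 2"
    by (subst vec_dim_card) simp
  ultimately show "V \<in> P1"
    by (auto simp: P1_def)
qed

lemma span_eq_iff_det2:
  fixes u v :: "'a::field ^2"
  assumes "u \<noteq> 0" "v \<noteq> 0"
  shows "vec.span {u} = vec.span {v} \<longleftrightarrow> det2 u v = 0"
proof
  assume "vec.span {u} = vec.span {v}"
  then show "det2 u v = 0"
    using in_span_singleton_iff_det2[OF assms(1)] vec.span_base[of v "{v}"] by auto
next
  assume "det2 u v = 0"
  then have "v \<in> vec.span {u}" "u \<in> vec.span {v}"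
    using assms by (simp_all add: in_span_singleton_iff_det2 det2_swap[of v u])
  then show "vec.span {u} = vec.span {v}"
    by (simp add: vec.span_eq)
qed

section \<open>Matrices fixing and moving lines\<close>

lemma image_span_singleton:
  fixes A :: "'a::field ^2^2"
  shows "(*v) A ` vec.span {v} = vec.span {A *v v}"
  by (simp add: vec.linear_span_image[symmetric])

lemma invertible_mult_neq_0:
  fixes A :: "'a::field ^2^2"
  assumes "invertible A" "v \<noteq> 0"
  shows "A *v v \<noteq> 0"
proof -
  obtain B where "B ** A = mat 1"
    using assms by (auto simp: invertible_def)
  then have "B *v (A *v v) = v"
    by (simp add: matrix_vector_mul_assoc)
  then show ?thesis using assms(2) by auto
qed

text \<open>Since \<open>A *v v\<close> is nonzero it spans the image line, so the determinant
  criterion for equal lines applies.\<close>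

lemma fixes_span_iff_det2:
  fixes A :: "'a::field ^2^2"
  assumes "invertible A" "v \<noteq> 0"
  shows "(*v) A ` vec.span {v} = vec.span {v} \<longleftrightarrow> det2 v (A *v v) = 0"
  using span_eq_iff_det2[of v "A *v v"] invertible_mult_neq_0[OF assms] assms(2)
  by (auto simp: image_span_singleton)

text \<open>
  \<open>A\<close> fixes the line of \<open>x\<close> iff the binary quadratic form \<open>det2 x (A x)\<close> vanishes, and a nonzero
  form has at most two zeros on the projective line.
\<close>

lemma fixes_three_lines_fixes_all:
  fixes A :: "'a::field ^2^2"
  assumes A: "invertible A"
    and P1: "V1 \<in> P1" "V2 \<in> P1" "V3 \<in> P1" "V \<in> P1"
    and distinct: "V1 \<noteq> V2" "V1 \<noteq> V3" "V2 \<noteq> V3"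
    and fixed: "(*v) A ` V1 = V1" "(*v) A ` V2 = V2" "(*v) A ` V3 = V3"
  shows "(*v) A ` V = V"
proof -
  obtain u v w x where eqs: "V1 = vec.span {u}" "V2 = vec.span {v}" "V3 = vec.span {w}"
      "V = vec.span {x}"
    and nz: "u \<noteq> 0" "v \<noteq> 0" "w \<noteq> 0" "x \<noteq> 0"
    using P1 unfolding P1_iff_span by blast
  have d: "det2 u v \<noteq> 0" "det2 u w \<noteq> 0" "det2 w v \<noteq> 0"
    using distinct nz by (auto simp: eqs span_eq_iff_det2 det2_swap[of w v])
  have q: "det2 u (A *v u) = 0" "det2 v (A *v v) = 0" "det2 w (A *v w) = 0"
    using fixed nz A by (auto simp: eqs fixes_span_iff_det2)
  \<comment> \<open>In coordinates relative to \<open>u\<close>, \<open>v\<close> the quadratic form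
    has no square terms, by the first two equations in \<open>q\<close>; \<open>m\<close> is its
    cross coefficient.\<close>
  define m where "m = det2 u (A *v v) + det2 v (A *v u)"
  have form: "det2 u v * det2 u v * det2 y (A *v y) = det2 y v * det2 u y * m" for y
  proof -
    let ?a = "det2 y v" and ?b = "det2 u y"
    have bilin: "det2 (c *s p + e *s r) (A *v (c *s p + e *s r)) =
        c * c * det2 p (A *v p) + c * e * (det2 p (A *v r) + det2 r (A *v p)) +
        e * e * det2 r (A *v r)" for c e p r
      by (simp add: det2_def matrix_vector_mult_def sum_2 algebra_simps)
    have "det2 u v * det2 u v * det2 y (A *v y) = det2 (det2 u v *s y) (A *v (det2 u v *s y))"
      by (simp add: det2_def matrix_vector_mult_def sum_2 algebra_simps)
    also have "\<dots> = ?a * ?b * m"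
      unfolding det2_cramer[of u v y] bilin by (simp add: q m_def)
    finally show ?thesis .
  qed
  \<comment> \<open>Both coordinates of \<open>w\<close> are nonzero, so a zero of the form at
    \<open>w\<close> kills the cross term and with it the whole form.\<close>
  have "m = 0"
    using form[of w] q d by simp
  then have "det2 x (A *v x) = 0"
    using form[of x] d by simp
  then show ?thesis
    using A nz by (simp add: eqs fixes_span_iff_det2)
qed

lemma fixes_two_lines_moves_third:
  fixes V1 :: "('a::field ^2) set"
  assumes large: "infinite (UNIV :: 'a set) \<or> card (UNIV :: 'a set) > 2"
    and P1: "V1 \<in> P1" "V2 \<in> P1" "V3 \<in> P1"
    and distinct: "V1 \<noteq> V2" "V1 \<noteq> V3" "V2 \<noteq> V3"
  shows "\<exists>A :: 'a^2^2. invertible A \<and> (*v) A ` V1 = V1 \<and> (*v) A ` V2 = V2 \<and> (*v) A ` V3 \<noteq> V3"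
proof -
  have "(UNIV :: 'a set) \<noteq> {0, 1}"
  proof
    assume UNIV: "(UNIV :: 'a set) = {0, 1}"
    from large show False unfolding UNIV by auto
  qed
  then obtain a :: 'a where a: "a \<noteq> 0" "a \<noteq> 1" by auto
  obtain u v w where eqs: "V1 = vec.span {u}" "V2 = vec.span {v}" "V3 = vec.span {w}"
    and nz: "u \<noteq> 0" "v \<noteq> 0" "w \<noteq> 0"
    using P1 unfolding P1_iff_span by blast
  have d: "det2 u v \<noteq> 0" "det2 u w \<noteq> 0" "det2 w v \<noteq> 0"
    using distinct nz by (auto simp: eqs span_eq_iff_det2 det2_swap[of w v])
  \<comment> \<open>By Cramer's rule this is \<open>det2 u v\<close> times the map with eigenvalue 1
    on \<open>u\<close> and \<open>a\<close> on \<open>v\<close>; the common factor avoids division.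
    The columns of \<open>A\<close> are the values of \<open>f\<close> on the standard
    basis.\<close>
  define f where "f x = det2 x v *s u + (a * det2 u x) *s v" for x
  define A where "A = (\<chi> i j. f (axis j 1) $ i)"
  have Av: "A *v x = f x" for x
    by (simp add: A_def f_def det2_def axis_def vec_eq_iff forall_2 matrix_vector_mult_def sum_2
        algebra_simps)
  have "det A = a * (det2 u v * det2 u v)"
    by (simp add: A_def f_def det_2 det2_def axis_def algebra_simps)
  then have inv: "invertible A"
    using a d by (simp add: invertible_det_nz)
  have "det2 u (f u) = 0" "det2 v (f v) = 0"
    by (simp_all add: f_def det2_def algebra_simps)
  \<comment> \<open>The line of \<open>w\<close> moves because the two eigenvalues differ and both
    coordinates of \<open>w\<close> are nonzero.\<close>
  moreover have "det2 w (f w) = (a - 1) * (det2 w v * det2 u w)"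
    by (simp add: f_def det2_def algebra_simps)
  then have "det2 w (f w) \<noteq> 0"
    using a d by simp
  ultimately have "det2 u (A *v u) = 0 \<and> det2 v (A *v v) = 0 \<and> det2 w (A *v w) \<noteq> 0"
    by (simp only: Av) simp
  then show ?thesis
    using inv nz by (intro exI[of _ A]) (simp only: eqs fixes_span_iff_det2 simp_thms)
qed

section \<open>Independent sets of lines\<close>

lemma G_independent_subset:
  assumes "G_independent G \<phi> Y" "Z \<subseteq> Y"
  shows "G_independent G \<phi> Z"
  using assms unfolding G_independent_def by (meson Diff_mono subset_iff subset_refl)

text \<open>On members of \<open>X\<close> the restricted action is the plain image map, so
  independence of \<open>Y\<close> does not depend on the ambient \<open>X\<close>.\<close>

lemma G_independent_GL_iff:
  assumes "Y \<subseteq> X"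
  shows "G_independent GL (GL_act X) Y \<longleftrightarrow>
    (\<forall>y\<in>Y. \<exists>A. invertible A \<and> (\<forall>z\<in>Y - {y}. (*v) A ` z = z) \<and> (*v) A ` y \<noteq> y)"
proof -
  have "GL_act X A V = (*v) A ` V" if "V \<in> Y" for A V
    using assms that by (auto simp: GL_act_def)
  then show ?thesis
    by (simp add: G_independent_def GL_def Bex_def)
qed

text \<open>Over any field the spans of \<open>e1\<close>, \<open>e2\<close> and
  \<open>e1 + e2\<close> are three distinct lines. Adding them to \<open>Y\<close> gives at least
  three lines, among which a three-element set containing \<open>Y\<close> can be chosen.\<close>

lemma ex_three_lines_superset:
  fixes Y :: "('a::field ^2) set set"
  assumes "Y \<subseteq> P1" "finite Y" "card Y \<le> 3"
  shows "\<exists>Z \<subseteq> P1. Y \<subseteq> Z \<and> card Z = 3"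
proof -
  define e1 e2 e3 :: "'a^2" where "e1 = axis 1 1" and "e2 = axis 2 1" and "e3 = e1 + e2"
  define T where "T = {vec.span {e1}, vec.span {e2}, vec.span {e3}}"
  have nz: "e1 \<noteq> 0" "e2 \<noteq> 0" "e3 \<noteq> 0"
    by (auto simp: e1_def e2_def e3_def axis_def vec_eq_iff forall_2)
  have "det2 e1 e2 \<noteq> 0" "det2 e1 e3 \<noteq> 0" "det2 e2 e3 \<noteq> 0"
    by (auto simp: e1_def e2_def e3_def axis_def det2_def)
  then have T: "T \<subseteq> P1" "card T = 3" "finite T"
    using nz by (auto simp: T_def span_eq_iff_det2 P1_iff_span)
  have "3 \<le> card (Y \<union> T)"
    using T assms card_mono[of "Y \<union> T" T] by simp
  then obtain Z where "Y \<subseteq> Z" "Z \<subseteq> Y \<union> T" "card Z = 3"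
    using exists_subset_between[of Y 3 "Y \<union> T"] assms T by auto
  moreover have "Z \<subseteq> P1"
    using \<open>Z \<subseteq> Y \<union> T\<close> assms(1) T(1) by (meson Un_least order_trans)
  ultimately show ?thesis
    by (intro exI[of _ Z]) simp
qed

lemma G_independent_lines_iff:
  fixes Y X :: "('a::field ^2) set set"
  assumes large: "infinite (UNIV :: 'a set) \<or> card (UNIV :: 'a set) > 2"
    and X: "P1 \<subseteq> X" and Y: "Y \<subseteq> P1"
  shows "G_independent GL (GL_act X) Y \<longleftrightarrow> finite Y \<and> card Y \<le> 3"
proof
  assume indep: "G_independent GL (GL_act X) Y"
  show "finite Y \<and> card Y \<le> 3"
  proof (rule ccontr)
    assume many: "\<not> ?thesis"
    \<comment> \<open>Four lines suffice for a contradiction: the witness for one of them fixes the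
      other three, hence every line. This covers infinite \<open>Y\<close> too.\<close>
    have "\<exists>T \<subseteq> Y. finite T \<and> card T = 4"
    proof (cases "finite Y")
      case True
      with many have "4 \<le> card Y" by simp
      then show ?thesis by (meson obtain_subset_with_card_n)
    next
      case False
      then show ?thesis using infinite_arbitrarily_large by blast
    qed
    then obtain T where T: "T \<subseteq> Y" "finite T" "card T = 4" by blast
    then obtain V where V: "V \<in> T" by fastforce
    then have "card (T - {V}) = 3"
      using T by simp
    then obtain V1 V2 V3 where V123: "T - {V} = {V1, V2, V3}" "V1 \<noteq> V2" "V1 \<noteq> V3" "V2 \<noteq> V3"
      by (metis card_3_iff)
    have TP: "T \<subseteq> P1" using T(1) Y by (rule order_trans)
    have "T \<subseteq> X" using TP X by (rule order_trans)
    then obtain A where A: "invertible A" "\<forall>z\<in>T - {V}. (*v) A ` z = z" "(*v) A ` V \<noteq> V"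
      using G_independent_GL_iff[of T X] G_independent_subset[OF indep T(1)] V by meson
    moreover have "V1 \<in> T - {V}" "V2 \<in> T - {V}" "V3 \<in> T - {V}"
      by (simp_all add: V123(1))
    then have "V1 \<in> P1" "V2 \<in> P1" "V3 \<in> P1" "V \<in> P1"
      using V TP by (simp_all add: subset_iff)
    ultimately show False
      using fixes_three_lines_fixes_all[of A V1 V2 V3 V] V123 by simp
  qed
next
  assume "finite Y \<and> card Y \<le> 3"
  \<comment> \<open>Enlarging to exactly three lines leaves exactly two to be fixed for each line to
    be moved; independence then passes back down to \<open>Y\<close>.\<close>
  then obtain Z where Z: "Z \<subseteq> P1" "Y \<subseteq> Z" "card Z = 3"
    using ex_three_lines_superset[OF Y] by metis
  have "\<exists>A. invertible A \<and> (\<forall>z\<in>Z - {V}. (*v) A ` z = z) \<and> (*v) A ` V \<noteq> V" if V: "V \<in> Z" for V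
  proof -
    have "card (Z - {V}) = 2"
      using Z V by simp
    then obtain V1 V2 where V12: "Z - {V} = {V1, V2}" "V1 \<noteq> V2"
      by (metis card_2_iff)
    then have "V1 \<in> Z" "V2 \<in> Z" "V1 \<noteq> V" "V2 \<noteq> V"
      by (metis Diff_iff insertCI)+
    then have "V1 \<in> P1" "V2 \<in> P1" "V \<in> P1"
      using Z(1) V by (simp_all add: subset_iff)
    then obtain A where "invertible A" "(*v) A ` V1 = V1" "(*v) A ` V2 = V2" "(*v) A ` V \<noteq> V"
      using fixes_two_lines_moves_third[OF large _ _ _ V12(2) \<open>V1 \<noteq> V\<close> \<open>V2 \<noteq> V\<close>] by metis
    then show ?thesis
      by (intro exI[of _ A]) (simp add: V12)
  qed
  then have "G_independent GL (GL_act X) Z"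
    by (simp add: G_independent_GL_iff[OF order_trans[OF Z(1) X]])
  then show "G_independent GL (GL_act X) Y"
    using Z(2) by (rule G_independent_subset)
qed

section \<open>Independence number and maximal independent sets\<close>

lemma G_independent_Sub_imp_P1:
  fixes Y :: "('a::field ^2) set set"
  assumes "Y \<subseteq> Sub" "G_independent GL (GL_act Sub) Y"
  shows "Y \<subseteq> P1"
proof -
  have "V \<noteq> {0} \<and> V \<noteq> UNIV" if "V \<in> Y" for V
  proof -
    obtain A where A: "invertible A" "(*v) A ` V \<noteq> V"
      using assms G_independent_GL_iff \<open>V \<in> Y\<close> by meson
    \<comment> \<open>Surjectivity makes \<open>A\<close> fix \<open>UNIV\<close>, and linearity
      makes it fix \<open>{0}\<close>, so neither can be the moved \<open>V\<close>.\<close>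
    moreover have "surj ((*v) A)"
      using A(1) matrix_right_invertible_surjective unfolding invertible_def by blast
    ultimately show ?thesis by auto
  qed
  then show ?thesis
    using assms by (auto simp: P1_def)
qed

text \<open>Treats \<open>Sub\<close> and \<open>P1\<close> together: both contain all lines, and
  their independent subsets consist of lines.\<close>

lemma indep_eq_3:
  fixes X :: "('a::field ^2) set set"
  assumes large: "infinite (UNIV :: 'a set) \<or> card (UNIV :: 'a set) > 2"
    and X: "P1 \<subseteq> X"
    and P1: "\<And>Y. Y \<subseteq> X \<Longrightarrow> G_independent GL (GL_act X) Y \<Longrightarrow> Y \<subseteq> P1"
  shows "indep GL X (GL_act X) = 3"
  unfolding indep_def
proof (rule antisym)
  show "(SUP Y\<in>{Y. Y \<subseteq> X \<and> G_independent GL (GL_act X) Y}. esize Y) \<le> 3"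
  proof (rule SUP_least)
    fix Y assume "Y \<in> {Y. Y \<subseteq> X \<and> G_independent GL (GL_act X) Y}"
    then have Y: "Y \<subseteq> X" "G_independent GL (GL_act X) Y"
      by simp_all
    then have "finite Y \<and> card Y \<le> 3"
      using G_independent_lines_iff[OF large X P1] by simp
    then show "esize Y \<le> 3"
      by (simp add: esize_def numeral_eq_enat)
  qed
  obtain Z :: "('a^2) set set" where Z: "Z \<subseteq> P1" "card Z = 3"
    using ex_three_lines_superset[of "{}"] by (metis card.empty empty_subsetI finite.emptyI zero_le)
  \<comment> \<open>Nonzero cardinality forces finiteness, which rules out the infinite branch of
    \<open>esize\<close>.\<close>
  then have fin: "finite Z"
    by (simp add: card_ge_0_finite)
  then have "esize Z = 3"
    using Z by (simp add: esize_def numeral_eq_enat)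
  moreover have "Z \<in> {Y. Y \<subseteq> X \<and> G_independent GL (GL_act X) Y}"
    using G_independent_lines_iff[OF large X Z(1)] Z X fin by simp
  ultimately show "3 \<le> (SUP Y\<in>{Y. Y \<subseteq> X \<and> G_independent GL (GL_act X) Y}. esize Y)"
    by (intro SUP_upper2[of Z]) simp_all
qed

text \<open>An independent set extends to three lines, which are again independent, so maximality
  forces equality. Conversely, an independent set containing three lines has at most three elements
  and cannot be larger.\<close>

lemma maximal_G_independent_Sub_iff:
  fixes Y :: "('a::field ^2) set set"
  assumes large: "infinite (UNIV :: 'a set) \<or> card (UNIV :: 'a set) > 2"
  shows "maximal_G_independent GL Sub (GL_act Sub) Y \<longleftrightarrow> Y \<subseteq> P1 \<and> card Y = 3"
proof -
  have P1_Sub: "P1 \<subseteq> (Sub :: ('a^2) set set)"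
    by (auto simp: P1_def)
  have iff: "G_independent GL (GL_act Sub) Z \<longleftrightarrow> finite Z \<and> card Z \<le> 3" if "Z \<subseteq> P1"
    for Z :: "('a^2) set set"
    using G_independent_lines_iff[OF large P1_Sub that] .
  have indep3: "G_independent GL (GL_act Sub) Z" if "Z \<subseteq> P1" "card Z = 3" for Z :: "('a^2) set set"
    using iff[OF that(1)] that(2) by (simp add: card_ge_0_finite)
  show ?thesis
  proof
    assume max: "maximal_G_independent GL Sub (GL_act Sub) Y"
    then have "Y \<subseteq> Sub" "G_independent GL (GL_act Sub) Y"
      by (simp_all add: maximal_G_independent_def)
    moreover from this have Y: "Y \<subseteq> P1"
      by (rule G_independent_Sub_imp_P1)
    ultimately obtain Z where Z: "Z \<subseteq> P1" "Y \<subseteq> Z" "card Z = 3"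
      using ex_three_lines_superset[OF Y] iff[OF Y] by metis
    have "Z \<subseteq> Sub"
      using Z(1) P1_Sub by (rule order_trans)
    then have "Z = Y"
      using max Z(2) indep3[OF Z(1,3)] by (simp add: maximal_G_independent_def)
    then show "Y \<subseteq> P1 \<and> card Y = 3"
      using Y Z(3) by simp
  next
    assume Y: "Y \<subseteq> P1 \<and> card Y = 3"
    have "Z = Y" if Z: "Z \<subseteq> Sub" "G_independent GL (GL_act Sub) Z" "Y \<subseteq> Z" for Z
    proof -
      have "finite Z \<and> card Z \<le> 3"
        using iff[OF G_independent_Sub_imp_P1[OF Z(1,2)]] Z(2) by simp
      then show ?thesis
        using card_seteq[of Z Y] Y Z(3) by simp
    qed
    moreover have "Y \<subseteq> Sub"
      using Y P1_Sub by (meson order_trans)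
    ultimately show "maximal_G_independent GL Sub (GL_act Sub) Y"
      using Y indep3[of Y] by (simp add: maximal_G_independent_def)
  qed
qed

theorem proposition4p2:
  assumes "infinite (UNIV :: 'a::field set) \<or> card (UNIV :: 'a set) > 2"
  shows "(\<forall>Y :: ('a ^2) set set.
            maximal_G_independent GL Sub (GL_act Sub) Y \<longleftrightarrow>
            Y \<subseteq> {V \<in> Sub. vec.dim V = 1} \<and> card Y = 3) \<and>
         indep GL Sub (GL_act (Sub :: ('a ^2) set set)) = 3 \<and>
         indep GL P1 (GL_act (P1 :: ('a ^2) set set)) = 3 \<and>
         (P1 :: ('a ^2) set set) = {V \<in> Sub. vec.dim V = 1}"
proof (intro conjI allI)
  show "indep GL Sub (GL_act (Sub :: ('a ^2) set set)) = 3"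
    by (rule indep_eq_3[OF assms]) (use G_independent_Sub_imp_P1 in \<open>auto simp: P1_def\<close>)
  show "indep GL P1 (GL_act (P1 :: ('a ^2) set set)) = 3"
    by (rule indep_eq_3[OF assms]) auto
qed (simp_all only: maximal_G_independent_Sub_iff[OF assms] P1_eq_dim_1)

end
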